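(* Let $N_H\in\mathbb{N}$ with $N_H\ge3$ and $\Delta t>0$. Let $(\mathbf{C}^m,E^m,\Phi^m)_{m\ge0}$, with $\mathbf{C}^m=(C_0^m,\dots,C_{N_H-1}^m)$ and all components in $V_h^k$, be a solution of the following two-stage second order scheme, where for every $m\ge0$, $(E^m,\Phi^m)$ solves the discrete Poisson problem with density coefficient $C_0^m$, and the step from $m$ to $m+1$ involves an intermediate state $\mathbf{C}^{(1)}=(C_0^{(1)},\dots,C_{N_H-1}^{(1)})$, $E^{(1)},\Phi^{(1)}$ in $V_h^k$ such that $(E^{(1)},\Phi^{(1)})$ solves the discrete Poisson problem with density coefficient $C_0^{(1)}$. First stage: for every $n\in\{0,\dots,N_H-1\}\setminus\{2\}$ and $\phi_n\in V_h^k$, $$\frac{2\,(C_n^{(1)}-C_n^m,\phi_n)}{\Delta t}+a_n(g_n^m,\phi_n)+b_n(\mathbf{C}^m,E^m,\Phi^m,\phi_n)=0,$$ and for every $\phi_2\in V_h^k$, $$\frac{2\,(C_2^{(1)}-C_2^m,\phi_2)}{\Delta t}+a_2(g_2^m,\phi_2)+b_2(\mathbf{C}^m,E^{m+\frac14},\Phi^{m+\frac14},\phi_2)=0,$$ with $E^{m+\frac14}=\frac12(E^m+E^{(1)})$, $\Phi^{m+\frac14}=\frac12(\Phi^m+\Phi^{(1)})$. Second stage: for every $n\in\{0,\dots,N_H-1\}\setminus\{2\}$ and $\phi_n\in V_h^k$, $$\frac{(C_n^{m+1}-C_n^m,\phi_n)}{\Delta t}+a_n(g_n^{(1)},\phi_n)+b_n(\mathbf{C}^{(1)},E^{(1)},\Phi^{(1)},\phi_n)=0,$$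 and for every $\phi_2\in V_h^k$, $$\frac{(C_2^{m+1}-C_2^m,\phi_2)}{\Delta t}+a_2(g_2^{(1)},\phi_2)+b_2(\mathbf{C}^{(1)},E^{m+\frac12},\Phi^{m+\frac12},\phi_2)=0,$$ with $E^{m+\frac12}=\frac12(E^m+E^{m+1})$, $\Phi^{m+\frac12}=\frac12(\Phi^m+\Phi^{m+1})$. Then discrete mass and momentum are conserved: for all $m\ge0$, $$v_{th}^{\ell+1}\int_0^L C_\ell^m\,dx=v_{th}^{\ell+1}\int_0^L C_\ell^0\,dx,\qquad \ell=0,1,$$ and the discrete total energy $$\mathcal{E}_h^m:=\frac12\int_0^L\left[v_{th}^3\left(\sqrt2\,C_2^m+C_0^m\right)+|E^m|^2\right]dx+\frac12\,\beta\sum_j[\Phi^m]^2_{j-\frac12}$$ is independent of $m\ge0$.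
   Context: Fix $L>0$, $v_{th}>0$, $\rho_0\in\mathbb{R}$, $\beta>0$ (a constant, possibly depending on the mesh size $h$, e.g. a constant times $1/h$), and an integer $k\ge0$. The interval $\Omega=[0,L]$ is partitioned by $0=x_{\frac12}<x_{\frac32}<\dots<x_{N_x+\frac12}=L$ into cells $I_j=[x_{j-\frac12},x_{j+\frac12}]$, $j=1,\dots,N_x$; periodic boundary conditions identify $x_{\frac12}$ and $x_{N_x+\frac12}$ (so at the interface $x_{\frac12}\equiv x_{N_x+\frac12}$ the left trace is taken from $I_{N_x}$ and the right trace from $I_1$). Set $V_h^k=\{u\in L^2(\Omega): u|_{I_j}\text{ is a polynomial of degree at most }k,\ \forall j\}$. For $u\in V_h^k$, $u^\pm_{j+\frac12}$ are the right ($+$) and left ($-$) limits at $x_{j+\frac12}$, $[u]_{j+\frac12}=u^+_{j+\frac12}-u^-_{j+\frac12}$ and $\{u\}_{j+\frac12}=\frac12(u^+_{j+\frac12}+u^-_{j+\frac12})$. Sums over $j$ run over $j=1,\dots,N_x$. $(\cdot,\cdot)$ is the $L^2(0,L)$ inner product and $(\cdot,\cdot)_{I_j}$ the $L^2(I_j)$ inner product. Discrete Poisson problem with density coefficient $C_0\in V_h^k$: $(E,\Phi)\in V_h^k\times V_h^k$ satisfies, for all cells $I_j$ and all $\eta,\zeta\in V_h^k$, $$\int_{I_j}\Phi\,\eta'\,dx-\hat\Phi_{j+\frac12}\eta^-_{j+\frac12}+\hat\Phi_{j-\frac12}\eta^+_{j-\frac12}=\int_{I_j}E\,\eta\,dx,$$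 $$-\int_{I_j}E\,\zeta'\,dx+\hat E_{j+\frac12}\zeta^-_{j+\frac12}-\hat E_{j-\frac12}\zeta^+_{j-\frac12}=\int_{I_j}(v_{th}C_0-\rho_0)\,\zeta\,dx,$$ with $\hat\Phi=\{\Phi\}$, $\hat E=\{E\}-\beta[\Phi]$ at every interface. Transport terms: for $\mathbf{C}=(C_0,\dots,C_{N_H-1})$, with conventions $C_{-1}=0$, $C_{N_H}=0$, let $g_n=v_{th}(\sqrt{n+1}\,C_{n+1}+\sqrt n\,C_{n-1})$, $\hat g_n=\frac12[g_n^-+g_n^+-\alpha(C_n^+-C_n^-)]$ with $\alpha=v_{th}\sqrt{N_H}$ (global Lax–Friedrichs flux), $$a_n^j(g_n,\phi)=-\int_{I_j}g_n\,\phi'\,dx+\hat g_{n,j+\frac12}\phi^-_{j+\frac12}-\hat g_{n,j-\frac12}\phi^+_{j-\frac12},\qquad a_n=\sum_j a_n^j,$$ and $\hat C_1=\hat g_0/v_{th}$. $g_n^m$ and $g_n^{(1)}$ denote $g_n$ (with its flux) computed from $\mathbf{C}^m$ and $\mathbf{C}^{(1)}$ respectively. Source terms: $b_n=\sum_j b_n^j$, where $b_0^j=0$, $b_1^j(\mathbf{C},E,\Phi,\phi)=-\frac1{v_{th}}(E\,C_0,\phi)_{I_j}-\langle r_1^j,\phi\rangle$, $b_2^j(\mathbf{C},E,\Phi,\phi)=-\frac{\sqrt2}{v_{th}}(E\,C_1,\phi)_{I_j}-\langle r_2^j,\phi\rangle$, $b_n^j(\mathbf{C},E,\Phi,\phi)=-\frac{\sqrt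 n}{v_{th}}(E\,C_{n-1},\phi)_{I_j}$ for $3\le n\le N_H-1$, with $$\langle r_1^j,\phi\rangle=-\frac{\beta}{2v_{th}^2}\left([\Phi]_{j-\frac12}[E]_{j-\frac12}\phi^+_{j-\frac12}+[\Phi]_{j+\frac12}[E]_{j+\frac12}\phi^-_{j+\frac12}\right),$$ $$\langle r_2^j,\phi\rangle=\frac1{\sqrt2\,v_{th}}\left((\{C_1\}-\hat C_1)_{j-\frac12}[\Phi]_{j-\frac12}\phi^+_{j-\frac12}+(\{C_1\}-\hat C_1)_{j+\frac12}[\Phi]_{j+\frac12}\phi^-_{j+\frac12}\right),$$ where $C_1,\hat C_1$ are computed from the argument $\mathbf{C}$ and $E,\Phi$ are the corresponding arguments of $b_n$. *)

theory Defs
  imports "HOL-Analysis.Analysis" "HOL-Computational_Algebra.Polynomial"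
begin

section \<open>Meshes and the broken polynomial space\<close>

text \<open>The interface $x_{j+1/2}$ is written \<open>x j\<close> for \<open>j = 0, \<dots>, N\<close>, so the cell $I_j$ is
  \<open>{x (j - 1)..x j}\<close> for \<open>j \<in> {1..N}\<close>. Every interface quantity below is indexed the same way:
  index \<open>j\<close> stands for the subscript $j+1/2$, and \<open>j - 1\<close> for $j-1/2$.\<close>

definition mesh :: "real \<Rightarrow> nat \<Rightarrow> (nat \<Rightarrow> real) \<Rightarrow> bool" where
  "mesh L N x \<longleftrightarrow> N \<ge> 1 \<and> x 0 = 0 \<and> x N = L \<and> (\<forall>j<N. x j < x (Suc j))"

text \<open>An element of $V_h^k$ is represented by a function that is a polynomial on each open cell.
  The values at the finitely many interfaces (where an element of the space is two-valued) and
  outside of $[0,L]$ are unconstrained and enter none of the definitions below, as these only use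
  integrals over the cells and one-sided limits.\<close>

definition Vh :: "nat \<Rightarrow> nat \<Rightarrow> (nat \<Rightarrow> real) \<Rightarrow> (real \<Rightarrow> real) set" where
  "Vh k N x = {u. \<forall>j\<in>{1..N}. \<exists>p :: real poly. degree p \<le> k \<and>
                   (\<forall>t\<in>{x (j - 1)<..<x j}. u t = poly p t)}"

text \<open>Left and right traces; the first and the last interface are identified by periodicity.\<close>

definition trm :: "nat \<Rightarrow> (nat \<Rightarrow> real) \<Rightarrow> (real \<Rightarrow> real) \<Rightarrow> nat \<Rightarrow> real" where
  "trm N x u j = Lim (at_left (x (if j = 0 then N else j))) u"

definition trp :: "nat \<Rightarrow> (nat \<Rightarrow> real) \<Rightarrow> (real \<Rightarrow> real) \<Rightarrow> nat \<Rightarrow> real" where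
  "trp N x u j = Lim (at_right (x (if j = N then 0 else j))) u"

definition jump :: "nat \<Rightarrow> (nat \<Rightarrow> real) \<Rightarrow> (real \<Rightarrow> real) \<Rightarrow> nat \<Rightarrow> real" where
  "jump N x u j = trp N x u j - trm N x u j"

definition avg :: "nat \<Rightarrow> (nat \<Rightarrow> real) \<Rightarrow> (real \<Rightarrow> real) \<Rightarrow> nat \<Rightarrow> real" where
  "avg N x u j = (trp N x u j + trm N x u j) / 2"

definition cell_integral :: "(nat \<Rightarrow> real) \<Rightarrow> nat \<Rightarrow> (real \<Rightarrow> real) \<Rightarrow> real" where
  "cell_integral x j f = integral {x (j - 1)..x j} f"

definition L2_inner :: "real \<Rightarrow> (real \<Rightarrow> real) \<Rightarrow> (real \<Rightarrow> real) \<Rightarrow> real" where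
  "L2_inner L u w = integral {0..L} (\<lambda>t. u t * w t)"

section \<open>The discrete Poisson problem\<close>

definition E_hat :: "real \<Rightarrow> nat \<Rightarrow> (nat \<Rightarrow> real) \<Rightarrow> (real \<Rightarrow> real) \<Rightarrow> (real \<Rightarrow> real) \<Rightarrow> nat \<Rightarrow> real" where
  "E_hat \<beta> N x E \<Phi> j = avg N x E j - \<beta> * jump N x \<Phi> j"

definition discrete_poisson ::
  "real \<Rightarrow> real \<Rightarrow> real \<Rightarrow> nat \<Rightarrow> nat \<Rightarrow> (nat \<Rightarrow> real) \<Rightarrow>
    (real \<Rightarrow> real) \<Rightarrow> (real \<Rightarrow> real) \<Rightarrow> (real \<Rightarrow> real) \<Rightarrow> bool" where
  "discrete_poisson vth \<rho>0 \<beta> k N x C0 E \<Phi> \<longleftrightarrow>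
     E \<in> Vh k N x \<and> \<Phi> \<in> Vh k N x \<and>
     (\<forall>j\<in>{1..N}. \<forall>\<eta>\<in>Vh k N x.
        cell_integral x j (\<lambda>t. \<Phi> t * deriv \<eta> t)
          - avg N x \<Phi> j * trm N x \<eta> j + avg N x \<Phi> (j - 1) * trp N x \<eta> (j - 1)
        = cell_integral x j (\<lambda>t. E t * \<eta> t)) \<and>
     (\<forall>j\<in>{1..N}. \<forall>\<zeta>\<in>Vh k N x.
        - cell_integral x j (\<lambda>t. E t * deriv \<zeta> t)
          + E_hat \<beta> N x E \<Phi> j * trm N x \<zeta> j - E_hat \<beta> N x E \<Phi> (j - 1) * trp N x \<zeta> (j - 1)
        = cell_integral x j (\<lambda>t. (vth * C0 t - \<rho>0) * \<zeta> t))"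

section \<open>Transport terms\<close>

text \<open>The Hermite coefficients with the conventions $C_{-1} = C_{N_H} = 0$.\<close>

definition coef :: "nat \<Rightarrow> (nat \<Rightarrow> real \<Rightarrow> real) \<Rightarrow> int \<Rightarrow> real \<Rightarrow> real" where
  "coef NH C i = (if 0 \<le> i \<and> i < int NH then C (nat i) else (\<lambda>t. 0))"

definition g :: "real \<Rightarrow> nat \<Rightarrow> (nat \<Rightarrow> real \<Rightarrow> real) \<Rightarrow> nat \<Rightarrow> real \<Rightarrow> real" where
  "g vth NH C n t = vth * (sqrt (real n + 1) * coef NH C (int n + 1) t
                           + sqrt (real n) * coef NH C (int n - 1) t)"

definition g_hat ::
  "real \<Rightarrow> nat \<Rightarrow> nat \<Rightarrow> (nat \<Rightarrow> real) \<Rightarrow> (nat \<Rightarrow> real \<Rightarrow> real) \<Rightarrow> nat \<Rightarrow> nat \<Rightarrow> real" where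
  "g_hat vth NH N x C n j =
     (let \<alpha> = vth * sqrt (real NH) in
      (trm N x (g vth NH C n) j + trp N x (g vth NH C n) j
        - \<alpha> * (trp N x (C n) j - trm N x (C n) j)) / 2)"

definition C1_hat ::
  "real \<Rightarrow> nat \<Rightarrow> nat \<Rightarrow> (nat \<Rightarrow> real) \<Rightarrow> (nat \<Rightarrow> real \<Rightarrow> real) \<Rightarrow> nat \<Rightarrow> real" where
  "C1_hat vth NH N x C j = g_hat vth NH N x C 0 j / vth"

text \<open>\<open>a_form vth NH N x C n \<phi>\<close> is $a_n(g_n,\phi)$ with $g_n$ and its flux computed from \<open>C\<close>.\<close>

definition a_cell ::
  "real \<Rightarrow> nat \<Rightarrow> nat \<Rightarrow> (nat \<Rightarrow> real) \<Rightarrow> (nat \<Rightarrow> real \<Rightarrow> real) \<Rightarrow> nat \<Rightarrow> (real \<Rightarrow> real) \<Rightarrow> nat \<Rightarrow> real" where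
  "a_cell vth NH N x C n \<phi> j =
     - cell_integral x j (\<lambda>t. g vth NH C n t * deriv \<phi> t)
     + g_hat vth NH N x C n j * trm N x \<phi> j
     - g_hat vth NH N x C n (j - 1) * trp N x \<phi> (j - 1)"

definition a_form ::
  "real \<Rightarrow> nat \<Rightarrow> nat \<Rightarrow> (nat \<Rightarrow> real) \<Rightarrow> (nat \<Rightarrow> real \<Rightarrow> real) \<Rightarrow> nat \<Rightarrow> (real \<Rightarrow> real) \<Rightarrow> real" where
  "a_form vth NH N x C n \<phi> = (\<Sum>j=1..N. a_cell vth NH N x C n \<phi> j)"

section \<open>Source terms\<close>

definition r1 ::
  "real \<Rightarrow> real \<Rightarrow> nat \<Rightarrow> (nat \<Rightarrow> real) \<Rightarrow> (real \<Rightarrow> real) \<Rightarrow> (real \<Rightarrow> real) \<Rightarrow>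
    (real \<Rightarrow> real) \<Rightarrow> nat \<Rightarrow> real" where
  "r1 vth \<beta> N x E \<Phi> \<phi> j =
     - \<beta> / (2 * vth\<^sup>2) *
       (jump N x \<Phi> (j - 1) * jump N x E (j - 1) * trp N x \<phi> (j - 1)
        + jump N x \<Phi> j * jump N x E j * trm N x \<phi> j)"

definition r2 ::
  "real \<Rightarrow> nat \<Rightarrow> nat \<Rightarrow> (nat \<Rightarrow> real) \<Rightarrow> (nat \<Rightarrow> real \<Rightarrow> real) \<Rightarrow> (real \<Rightarrow> real) \<Rightarrow>
    (real \<Rightarrow> real) \<Rightarrow> nat \<Rightarrow> real" where
  "r2 vth NH N x C \<Phi> \<phi> j =
     1 / (sqrt 2 * vth) *
       ((avg N x (C 1) (j - 1) - C1_hat vth NH N x C (j - 1)) * jump N x \<Phi> (j - 1) * trp N x \<phi> (j - 1)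
        + (avg N x (C 1) j - C1_hat vth NH N x C j) * jump N x \<Phi> j * trm N x \<phi> j)"

definition b_cell ::
  "real \<Rightarrow> real \<Rightarrow> nat \<Rightarrow> nat \<Rightarrow> (nat \<Rightarrow> real) \<Rightarrow> nat \<Rightarrow> (nat \<Rightarrow> real \<Rightarrow> real) \<Rightarrow>
    (real \<Rightarrow> real) \<Rightarrow> (real \<Rightarrow> real) \<Rightarrow> (real \<Rightarrow> real) \<Rightarrow> nat \<Rightarrow> real" where
  "b_cell vth \<beta> NH N x n C E \<Phi> \<phi> j =
     (if n = 0 then 0
      else if n = 1 then
        - (1 / vth) * cell_integral x j (\<lambda>t. E t * C 0 t * \<phi> t) - r1 vth \<beta> N x E \<Phi> \<phi> j
      else if n = 2 then
        - (sqrt 2 / vth) * cell_integral x j (\<lambda>t. E t * C 1 t * \<phi> t) - r2 vth NH N x C \<Phi> \<phi> j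
      else
        - (sqrt (real n) / vth) * cell_integral x j (\<lambda>t. E t * C (n - 1) t * \<phi> t))"

definition b_form ::
  "real \<Rightarrow> real \<Rightarrow> nat \<Rightarrow> nat \<Rightarrow> (nat \<Rightarrow> real) \<Rightarrow> nat \<Rightarrow> (nat \<Rightarrow> real \<Rightarrow> real) \<Rightarrow>
    (real \<Rightarrow> real) \<Rightarrow> (real \<Rightarrow> real) \<Rightarrow> (real \<Rightarrow> real) \<Rightarrow> real" where
  "b_form vth \<beta> NH N x n C E \<Phi> \<phi> = (\<Sum>j=1..N. b_cell vth \<beta> NH N x n C E \<Phi> \<phi> j)"

section \<open>The two-stage scheme\<close>

definition midpoint_fun :: "(real \<Rightarrow> real) \<Rightarrow> (real \<Rightarrow> real) \<Rightarrow> real \<Rightarrow> real" where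
  "midpoint_fun u w t = (u t + w t) / 2"

definition first_stage ::
  "real \<Rightarrow> real \<Rightarrow> real \<Rightarrow> nat \<Rightarrow> nat \<Rightarrow> nat \<Rightarrow> (nat \<Rightarrow> real) \<Rightarrow> real \<Rightarrow>
    (nat \<Rightarrow> real \<Rightarrow> real) \<Rightarrow> (real \<Rightarrow> real) \<Rightarrow> (real \<Rightarrow> real) \<Rightarrow>
    (nat \<Rightarrow> real \<Rightarrow> real) \<Rightarrow> (real \<Rightarrow> real) \<Rightarrow> (real \<Rightarrow> real) \<Rightarrow> bool" where
  "first_stage L vth \<beta> k NH N x dt C E \<Phi> C' E' \<Phi>' \<longleftrightarrow>
     (\<forall>n\<in>{0..<NH} - {2}. \<forall>\<phi>\<in>Vh k N x.
        2 * L2_inner L (\<lambda>t. C' n t - C n t) \<phi> / dt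
          + a_form vth NH N x C n \<phi> + b_form vth \<beta> NH N x n C E \<Phi> \<phi> = 0) \<and>
     (\<forall>\<phi>\<in>Vh k N x.
        2 * L2_inner L (\<lambda>t. C' 2 t - C 2 t) \<phi> / dt
          + a_form vth NH N x C 2 \<phi>
          + b_form vth \<beta> NH N x 2 C (midpoint_fun E E') (midpoint_fun \<Phi> \<Phi>') \<phi> = 0)"

text \<open>\<open>(C, E, \<Phi>)\<close> is the state at time level $m$, \<open>(C', E', \<Phi>')\<close> the intermediate state and
  \<open>(C'', E'', \<Phi>'')\<close> the state at time level $m+1$.\<close>

definition second_stage ::
  "real \<Rightarrow> real \<Rightarrow> real \<Rightarrow> nat \<Rightarrow> nat \<Rightarrow> nat \<Rightarrow> (nat \<Rightarrow> real) \<Rightarrow> real \<Rightarrow>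
    (nat \<Rightarrow> real \<Rightarrow> real) \<Rightarrow> (real \<Rightarrow> real) \<Rightarrow> (real \<Rightarrow> real) \<Rightarrow>
    (nat \<Rightarrow> real \<Rightarrow> real) \<Rightarrow> (real \<Rightarrow> real) \<Rightarrow> (real \<Rightarrow> real) \<Rightarrow>
    (nat \<Rightarrow> real \<Rightarrow> real) \<Rightarrow> (real \<Rightarrow> real) \<Rightarrow> (real \<Rightarrow> real) \<Rightarrow> bool" where
  "second_stage L vth \<beta> k NH N x dt C E \<Phi> C' E' \<Phi>' C'' E'' \<Phi>'' \<longleftrightarrow>
     (\<forall>n\<in>{0..<NH} - {2}. \<forall>\<phi>\<in>Vh k N x.
        L2_inner L (\<lambda>t. C'' n t - C n t) \<phi> / dt
          + a_form vth NH N x C' n \<phi> + b_form vth \<beta> NH N x n C' E' \<Phi>' \<phi> = 0) \<and>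
     (\<forall>\<phi>\<in>Vh k N x.
        L2_inner L (\<lambda>t. C'' 2 t - C 2 t) \<phi> / dt
          + a_form vth NH N x C' 2 \<phi>
          + b_form vth \<beta> NH N x 2 C' (midpoint_fun E E'') (midpoint_fun \<Phi> \<Phi>'') \<phi> = 0)"

section \<open>The discrete total energy\<close>

definition total_energy ::
  "real \<Rightarrow> real \<Rightarrow> real \<Rightarrow> nat \<Rightarrow> (nat \<Rightarrow> real) \<Rightarrow>
    (nat \<Rightarrow> real \<Rightarrow> real) \<Rightarrow> (real \<Rightarrow> real) \<Rightarrow> (real \<Rightarrow> real) \<Rightarrow> real" where
  "total_energy L vth \<beta> N x C E \<Phi> =
     1 / 2 * integral {0..L} (\<lambda>t. vth ^ 3 * (sqrt 2 * C 2 t + C 0 t) + \<bar>E t\<bar>\<^sup>2)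
     + 1 / 2 * \<beta> * (\<Sum>j=1..N. (jump N x \<Phi> (j - 1))\<^sup>2)"

end

theory Submission
  imports Defs
begin

text \<open>All identities come from testing the scheme with functions of the broken polynomial space.
  Testing with \<open>1\<close> makes the numerical fluxes telescope. For momentum, the Poisson problem tested
  with \<open>E\<close> gives $v_{th}\int E C_0 = \beta\sum_j [\Phi]_j[E]_j$, which is exactly what the correction
  \<open>r1\<close> compensates. For the energy, any two Poisson solutions satisfy
  $\int E E^* + \beta\sum_j[\Phi]_j[\Phi^*]_j = \int (v_{th} C_0^* - \rho_0)\Phi$, and the left-hand
  side is symmetric; so the field energy changes by
  $v_{th}\int (C_0^{m+1}-C_0^m)\,\Phi^{m+1/2}$, which the equation for $C_0$ tested with
  $\Phi^{m+1/2}$ and the equation for $C_2$ tested with \<open>1\<close> cancel against the change of the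
  kinetic energy.\<close>

section \<open>The broken polynomial space\<close>

lemma trm_periodic: "trm N x u 0 = trm N x u N"
  by (simp add: trm_def)

lemma trp_periodic: "trp N x u 0 = trp N x u N"
  by (simp add: trp_def)

lemma jump_periodic: "jump N x u 0 = jump N x u N"
  by (simp add: jump_def trm_periodic trp_periodic)

lemma avg_periodic: "avg N x u 0 = avg N x u N"
  by (simp add: avg_def trm_periodic trp_periodic)

lemma g_hat_periodic: "g_hat vth NH N x C n 0 = g_hat vth NH N x C n N"
  by (simp add: g_hat_def trm_periodic trp_periodic)

lemma VhI:
  assumes "\<And>j. j \<in> {1..N} \<Longrightarrow> \<exists>p. degree p \<le> k \<and> (\<forall>t\<in>{x (j - 1)<..<x j}. u t = poly p t)"
  shows "u \<in> Vh k N x"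
  using assms by (simp add: Vh_def)

lemma VhE:
  assumes "u \<in> Vh k N x" "j \<in> {1..N}"
  obtains p where "degree p \<le> k" "\<And>t. t \<in> {x (j - 1)<..<x j} \<Longrightarrow> u t = poly p t"
  using assms unfolding Vh_def by blast

lemma Vh_const: "(\<lambda>t. c) \<in> Vh k N x"
proof (rule VhI)
  fix j
  show "\<exists>p. degree p \<le> k \<and> (\<forall>t\<in>{x (j - 1)<..<x j}. c = poly p t)"
    by (rule exI[of _ "[:c:]"]) simp
qed

lemma Vh_add:
  assumes "u \<in> Vh k N x" "w \<in> Vh k N x"
  shows "(\<lambda>t. u t + w t) \<in> Vh k N x"
proof (rule VhI)
  fix j assume j: "j \<in> {1..N}"
  obtain p where p: "degree p \<le> k" "\<And>t. t \<in> {x (j - 1)<..<x j} \<Longrightarrow> u t = poly p t"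
    using VhE[OF assms(1) j] by blast
  obtain q where q: "degree q \<le> k" "\<And>t. t \<in> {x (j - 1)<..<x j} \<Longrightarrow> w t = poly q t"
    using VhE[OF assms(2) j] by blast
  show "\<exists>p. degree p \<le> k \<and> (\<forall>t\<in>{x (j - 1)<..<x j}. u t + w t = poly p t)"
    by (rule exI[of _ "p + q"]) (use p q in \<open>auto intro: degree_add_le\<close>)
qed

text \<open>Products leave the space of degree \<open>k\<close>, but membership for some degree
  suffices for integrability and for traces. A constant enters as a factor of degree 0, which keeps
  the degree.\<close>

lemma Vh_mult:
  assumes "u \<in> Vh k N x" "w \<in> Vh l N x"
  shows "(\<lambda>t. u t * w t) \<in> Vh (k + l) N x"
proof (rule VhI)
  fix j assume j: "j \<in> {1..N}"
  obtain p where p: "degree p \<le> k" "\<And>t. t \<in> {x (j - 1)<..<x j} \<Longrightarrow> u t = poly p t"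
    using VhE[OF assms(1) j] by blast
  obtain q where q: "degree q \<le> l" "\<And>t. t \<in> {x (j - 1)<..<x j} \<Longrightarrow> w t = poly q t"
    using VhE[OF assms(2) j] by blast
  show "\<exists>p. degree p \<le> k + l \<and> (\<forall>t\<in>{x (j - 1)<..<x j}. u t * w t = poly p t)"
    by (rule exI[of _ "p * q"]) (use p q degree_mult_le[of p q] in auto)
qed

text \<open>Inside an open cell the derivative depends only on nearby values, so the free values at
  the interfaces cannot disturb it.\<close>

lemma has_field_derivative_poly_on_interval:
  fixes u :: "real \<Rightarrow> real"
  assumes "\<And>t. t \<in> {a<..<b} \<Longrightarrow> u t = poly p t" "t \<in> {a<..<b}"
  shows "(u has_field_derivative poly (pderiv p) t) (at t)"
  by (rule has_field_derivative_transform_within_open[of "poly p" _ _ "{a<..<b}"])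
     (use assms in \<open>auto simp: poly_DERIV\<close>)

lemma Vh_has_field_derivative:
  assumes "u \<in> Vh k N x" "j \<in> {1..N}" "t \<in> {x (j - 1)<..<x j}"
  shows "(u has_field_derivative deriv u t) (at t)"
proof -
  obtain p where p: "\<And>t. t \<in> {x (j - 1)<..<x j} \<Longrightarrow> u t = poly p t"
    using VhE[OF assms(1,2)] by blast
  from has_field_derivative_poly_on_interval[OF p assms(3)] show ?thesis
    using DERIV_imp_deriv by metis
qed

lemma Vh_deriv:
  assumes "u \<in> Vh k N x"
  shows "deriv u \<in> Vh k N x"
proof (rule VhI)
  fix j assume j: "j \<in> {1..N}"
  obtain p where p: "degree p \<le> k" "\<And>t. t \<in> {x (j - 1)<..<x j} \<Longrightarrow> u t = poly p t"
    using VhE[OF assms j] by blast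
  have "deriv u t = poly (pderiv p) t" if t: "t \<in> {x (j - 1)<..<x j}" for t
    by (rule DERIV_imp_deriv[OF has_field_derivative_poly_on_interval[OF p(2) t]])
  then show "\<exists>p. degree p \<le> k \<and> (\<forall>t\<in>{x (j - 1)<..<x j}. deriv u t = poly p t)"
    using p(1) by (intro exI[of _ "pderiv p"]) (auto simp: degree_pderiv)
qed

lemma Vh_midpoint_fun:
  assumes "u \<in> Vh k N x" "w \<in> Vh k N x"
  shows "midpoint_fun u w \<in> Vh k N x"
  using Vh_mult[OF Vh_const[of "1 / 2" 0] Vh_add[OF assms]]
  by (simp add: midpoint_fun_def[abs_def])

section \<open>Traces and jumps at the interfaces of a fixed mesh\<close>

context
  fixes L :: real and N :: nat and x :: "nat \<Rightarrow> real"
  assumes mesh: "mesh L N x"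
begin

lemma mesh_less:
  assumes "j \<in> {1..N}"
  shows "x (j - 1) < x j"
proof -
  have "j - 1 < N" "Suc (j - 1) = j"
    using assms by auto
  then show ?thesis
    using mesh unfolding mesh_def by metis
qed

lemma trm_tendsto_poly:
  assumes "j \<in> {1..N}" "\<And>t. t \<in> {x (j - 1)<..<x j} \<Longrightarrow> u t = poly p t"
  shows "(u \<longlongrightarrow> poly p (x j)) (at_left (x j))"
proof -
  have "eventually (\<lambda>t. u t = poly p t) (at_left (x j))"
    using eventually_at_left_real[OF mesh_less[OF assms(1)]]
    by eventually_elim (use assms(2) in auto)
  moreover have "(poly p \<longlongrightarrow> poly p (x j)) (at_left (x j))"
    by (intro tendsto_intros)
  ultimately show ?thesis
    by (simp cong: tendsto_cong)
qed

lemma trp_tendsto_poly: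
  assumes "j \<in> {1..N}" "\<And>t. t \<in> {x (j - 1)<..<x j} \<Longrightarrow> u t = poly p t"
  shows "(u \<longlongrightarrow> poly p (x (j - 1))) (at_right (x (j - 1)))"
proof -
  have "eventually (\<lambda>t. u t = poly p t) (at_right (x (j - 1)))"
    using eventually_at_right_real[OF mesh_less[OF assms(1)]]
    by eventually_elim (use assms(2) in auto)
  moreover have "(poly p \<longlongrightarrow> poly p (x (j - 1))) (at_right (x (j - 1)))"
    by (intro tendsto_intros)
  ultimately show ?thesis
    by (simp cong: tendsto_cong)
qed

text \<open>\<open>Lim\<close> denotes the limit once one is exhibited; uniqueness then identifies
  it. For \<open>j \<in> {1..N}\<close> the index \<open>j\<close> is never 0, so the periodic
  switch in \<open>trm\<close> stays off; likewise \<open>j - 1\<close> is never \<open>N\<close> in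
  \<open>trp_eqI\<close>.\<close>

lemma trm_eqI: "j \<in> {1..N} \<Longrightarrow> (u \<longlongrightarrow> c) (at_left (x j)) \<Longrightarrow> trm N x u j = c"
  by (auto simp: trm_def intro!: tendsto_Lim)

lemma trp_eqI: "j \<in> {1..N} \<Longrightarrow> (u \<longlongrightarrow> c) (at_right (x (j - 1))) \<Longrightarrow> trp N x u (j - 1) = c"
  by (auto simp: trp_def intro!: tendsto_Lim)

lemma trm_tendsto:
  assumes "u \<in> Vh k N x" "j \<in> {1..N}"
  shows "(u \<longlongrightarrow> trm N x u j) (at_left (x j))"
  using VhE[OF assms] trm_tendsto_poly[OF assms(2)] trm_eqI[OF assms(2)] by metis

lemma trp_tendsto:
  assumes "u \<in> Vh k N x" "j \<in> {1..N}"
  shows "(u \<longlongrightarrow> trp N x u (j - 1)) (at_right (x (j - 1)))"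
  using VhE[OF assms] trp_tendsto_poly[OF assms(2)] trp_eqI[OF assms(2)] by metis

lemma trm_mult:
  assumes "u \<in> Vh k N x" "w \<in> Vh l N x" "j \<in> {1..N}"
  shows "trm N x (\<lambda>t. u t * w t) j = trm N x u j * trm N x w j"
  using assms by (intro trm_eqI tendsto_mult trm_tendsto)

lemma trp_mult:
  assumes "u \<in> Vh k N x" "w \<in> Vh l N x" "j \<in> {1..N}"
  shows "trp N x (\<lambda>t. u t * w t) (j - 1) = trp N x u (j - 1) * trp N x w (j - 1)"
  using assms by (intro trp_eqI tendsto_mult trp_tendsto)

lemma trm_const: "j \<in> {1..N} \<Longrightarrow> trm N x (\<lambda>t. c) j = c"
  by (rule trm_eqI) auto

lemma trp_const: "j \<in> {1..N} \<Longrightarrow> trp N x (\<lambda>t. c) (j - 1) = c"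
  by (rule trp_eqI) auto

text \<open>Right traces are computed at the left end \<open>i - 1\<close> of a cell. Interface
  \<open>j\<close> is the left end of cell \<open>Suc j\<close>, except that \<open>N\<close> wraps
  around to the left end of cell 1.\<close>

lemma trp_interface:
  assumes "j \<in> {1..N}"
  obtains i where "i \<in> {1..N}" "\<And>u. trp N x u j = trp N x u (i - 1)"
proof (cases "j = N")
  case True
  then show ?thesis
    using that[of 1] assms by (simp add: trp_periodic)
next
  case False
  then show ?thesis
    using that[of "Suc j"] assms by simp
qed

lemma jump_midpoint_fun:
  assumes "u \<in> Vh k N x" "w \<in> Vh k N x" "j \<in> {1..N}"
  shows "jump N x (midpoint_fun u w) j = (jump N x u j + jump N x w j) / 2"
proof -
  have m: "trm N x (midpoint_fun u w) j = (trm N x u j + trm N x w j) / 2"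
    unfolding midpoint_fun_def[abs_def]
    using assms by (intro trm_eqI tendsto_divide tendsto_add trm_tendsto tendsto_const) auto
  obtain i where i: "i \<in> {1..N}" "\<And>u. trp N x u j = trp N x u (i - 1)"
    using trp_interface[OF assms(3)] by blast
  have "trp N x (midpoint_fun u w) j = (trp N x u j + trp N x w j) / 2"
    unfolding midpoint_fun_def[abs_def] i(2)
    using assms i by (intro trp_eqI tendsto_divide tendsto_add trp_tendsto tendsto_const) auto
  with m show ?thesis
    by (simp add: jump_def field_simps)
qed

lemma jump_const: "j \<in> {1..N} \<Longrightarrow> jump N x (\<lambda>t. c) j = 0"
  by (metis jump_def trm_const trp_const trp_interface diff_self)

section \<open>Integrals over the cells and over the whole interval\<close>

lemma Vh_integrable_cell:
  assumes "u \<in> Vh k N x" "j \<in> {1..N}"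
  shows "u integrable_on {x (j - 1)..x j}"
proof -
  obtain p where p: "\<And>t. t \<in> {x (j - 1)<..<x j} \<Longrightarrow> u t = poly p t"
    using VhE[OF assms] by blast
  have "poly p integrable_on {x (j - 1)..x j}"
    by (intro integrable_continuous_interval continuous_intros)
  then show ?thesis
    by (rule integrable_spike_finite[of "{x (j - 1), x j}", rotated 2]) (use p in auto)
qed

text \<open>The fundamental theorem of calculus for the polynomial representative, whose endpoint
  values are the traces; the two endpoints, where \<open>deriv u\<close> is uncontrolled, form a
  null set.\<close>

lemma cell_integral_deriv:
  assumes "u \<in> Vh k N x" "j \<in> {1..N}"
  shows "cell_integral x j (deriv u) = trm N x u j - trp N x u (j - 1)"
proof -
  obtain p where p: "\<And>t. t \<in> {x (j - 1)<..<x j} \<Longrightarrow> u t = poly p t"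
    using VhE[OF assms] by blast
  have d: "deriv u t = poly (pderiv p) t" if t: "t \<in> {x (j - 1)<..<x j}" for t
    by (rule DERIV_imp_deriv[OF has_field_derivative_poly_on_interval[OF p t]])
  have "((\<lambda>t. poly (pderiv p) t) has_integral poly p (x j) - poly p (x (j - 1))) {x (j - 1)..x j}"
    using mesh_less[OF assms(2)]
    by (intro fundamental_theorem_of_calculus)
       (auto simp: poly_DERIV has_real_derivative_iff_has_vector_derivative[symmetric]
             intro: has_field_derivative_at_within)
  then have "(deriv u has_integral poly p (x j) - poly p (x (j - 1))) {x (j - 1)..x j}"
    by (rule has_integral_spike_finite[of "{x (j - 1), x j}", rotated 2]) (use d in auto)
  moreover have "trm N x u j = poly p (x j)"
    by (rule trm_eqI[OF assms(2) trm_tendsto_poly[OF assms(2) p]])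
  moreover have "trp N x u (j - 1) = poly p (x (j - 1))"
    by (rule trp_eqI[OF assms(2) trp_tendsto_poly[OF assms(2) p]])
  ultimately show ?thesis
    by (simp add: cell_integral_def integral_unique)
qed

lemma Vh_has_integral:
  assumes "u \<in> Vh k N x"
  shows "(u has_integral (\<Sum>j=1..N. cell_integral x j u)) {0..L}"
proof -
  \<comment> \<open>The inequality \<open>x 0 \<le> x n\<close> is carried along because gluing two
    adjacent integrals asks for ordered endpoints.\<close>
  have "x 0 \<le> x n \<and> (u has_integral (\<Sum>j=1..n. cell_integral x j u)) {x 0..x n}" if "n \<le> N" for n
    using that
  proof (induction n)
    case 0
    then show ?case
      using has_integral_refl(2)[of u "x 0"] by simp
  next
    case (Suc n)
    have j: "Suc n \<in> {1..N}"
      using Suc.prems by simp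
    have le: "x n \<le> x (Suc n)"
      using mesh_less[OF j] by simp
    have IH: "x 0 \<le> x n" "(u has_integral (\<Sum>j=1..n. cell_integral x j u)) {x 0..x n}"
      using Suc by auto
    have "(u has_integral cell_integral x (Suc n) u) {x n..x (Suc n)}"
      using Vh_integrable_cell[OF assms j] by (simp add: cell_integral_def has_integral_integral)
    from has_integral_combine[OF IH(1) le IH(2) this] show ?case
      using IH(1) le by simp
  qed
  from this[of N] show ?thesis
    using mesh by (simp add: mesh_def)
qed

lemma Vh_integrable: "u \<in> Vh k N x \<Longrightarrow> u integrable_on {0..L}"
  using Vh_has_integral by blast

lemma sum_cell_integral:
  "u \<in> Vh k N x \<Longrightarrow> (\<Sum>j=1..N. cell_integral x j u) = integral {0..L} u"
  using integral_unique[OF Vh_has_integral] by (rule sym)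

lemma sum_shift_periodic:

  \<comment> \<open>Summation and integration by parts on the periodic mesh\<close>
  fixes a :: "nat \<Rightarrow> real"
  assumes "a 0 = a N"
  shows "(\<Sum>j=1..N. a (j - 1)) = (\<Sum>j=1..N. a j)"
  using sum_telescope''[of 0 N a] assms by (simp add: sum_subtractf)

text \<open>A single-valued flux \<open>a\<close> meets the traces from the two neighbouring cells
  with opposite signs, so shifting the left-end terms by one index leaves a jump at each
  interface.\<close>

lemma sum_flux:
  assumes "a 0 = a N"
  shows "(\<Sum>j=1..N. a j * trm N x u j - a (j - 1) * trp N x u (j - 1))
         = - (\<Sum>j=1..N. a j * jump N x u j)"
  using sum_shift_periodic[of "\<lambda>j. a j * trp N x u j"] assms
  by (simp add: jump_def sum_subtractf algebra_simps trp_periodic)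

text \<open>Common shape of the two Poisson equations and of the transport form for
  \<open>n = 0\<close>, where \<open>c\<close> is 1, -1 and \<open>- vth\<close>
  respectively.\<close>

lemma sum_cell_flux:
  assumes "f \<in> Vh k N x" "a 0 = a N"
  shows "(\<Sum>j=1..N. c * cell_integral x j f + (a j * trm N x u j - a (j - 1) * trp N x u (j - 1)))
         = c * integral {0..L} f - (\<Sum>j=1..N. a j * jump N x u j)"
  by (simp only: sum.distrib sum_distrib_left[symmetric] sum_cell_integral[OF assms(1)]
        sum_flux[where a = a, OF assms(2)] diff_conv_add_uminus[symmetric])

text \<open>On each cell this is the product rule. Summation leaves minus the jump of
  \<open>u * w\<close>, and the jump of a product is the average of each factor times the jump of
  the other, added up.\<close>

lemma integral_by_parts:
  assumes u: "u \<in> Vh k N x" and w: "w \<in> Vh l N x"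
  shows "integral {0..L} (\<lambda>t. u t * deriv w t) + integral {0..L} (\<lambda>t. w t * deriv u t)
         = - (\<Sum>j=1..N. avg N x u j * jump N x w j + avg N x w j * jump N x u j)"
proof -
  have uw: "(\<lambda>t. u t * w t) \<in> Vh (k + l) N x"
    using u w by (rule Vh_mult)
  have i: "(\<lambda>t. u t * deriv w t) \<in> Vh (k + l) N x" "(\<lambda>t. w t * deriv u t) \<in> Vh (l + k) N x"
    using u w by (auto intro: Vh_mult Vh_deriv)
  have "cell_integral x j (\<lambda>t. u t * deriv w t) + cell_integral x j (\<lambda>t. w t * deriv u t)
        = trm N x u j * trm N x w j - trp N x u (j - 1) * trp N x w (j - 1)" if j: "j \<in> {1..N}" for j
  proof -
    have "cell_integral x j (\<lambda>t. u t * deriv w t) + cell_integral x j (\<lambda>t. w t * deriv u t)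
          = cell_integral x j (\<lambda>t. u t * deriv w t + w t * deriv u t)"
      unfolding cell_integral_def using i j by (intro integral_add[symmetric] Vh_integrable_cell)
    also have "\<dots> = cell_integral x j (deriv (\<lambda>t. u t * w t))"
      unfolding cell_integral_def
    proof (rule integral_spike[of "{x (j - 1), x j}"])
      fix t assume "t \<in> {x (j - 1)..x j} - {x (j - 1), x j}"
      then have t: "t \<in> {x (j - 1)<..<x j}" by auto
      from DERIV_mult[OF Vh_has_field_derivative[OF u j t] Vh_has_field_derivative[OF w j t]]
      show "deriv (\<lambda>t. u t * w t) t = u t * deriv w t + w t * deriv u t"
        by (simp add: DERIV_imp_deriv algebra_simps)
    qed simp
    also have "\<dots> = trm N x u j * trm N x w j - trp N x u (j - 1) * trp N x w (j - 1)"
      by (simp only: cell_integral_deriv[OF uw j] trm_mult[OF u w j] trp_mult[OF u w j])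
    finally show ?thesis .
  qed
  then have "integral {0..L} (\<lambda>t. u t * deriv w t) + integral {0..L} (\<lambda>t. w t * deriv u t)
      = (\<Sum>j=1..N. trm N x u j * trm N x w j - trp N x u (j - 1) * trp N x w (j - 1))"
    by (simp add: sum_cell_integral[OF i(1), symmetric] sum_cell_integral[OF i(2), symmetric]
                  sum.distrib[symmetric])
  also have "\<dots> = (\<Sum>j=1..N. trm N x u j * trm N x w j - trp N x u j * trp N x w j)"
    using sum_shift_periodic[of "\<lambda>j. trp N x u j * trp N x w j"]
    by (simp add: sum_subtractf trp_periodic)
  also have "\<dots> = - (\<Sum>j=1..N. avg N x u j * jump N x w j + avg N x w j * jump N x u j)"
    unfolding sum_negf[symmetric] by (rule sum.cong) (auto simp: avg_def jump_def field_simps)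
  finally show ?thesis .
qed

section \<open>The discrete Poisson problem\<close>

text \<open>Summing the first Poisson equation gives the derivative of \<open>\<eta>\<close> and the
  average of \<open>\<Phi>\<close>; integration by parts moves the derivative to
  \<open>\<Phi>\<close>. In this form it pairs with the divergence equation tested with
  \<open>\<Phi>\<close>, and with the transport of \<open>C 1\<close> in the energy balance.\<close>

lemma poisson_gradient:
  assumes P: "discrete_poisson vth \<rho>0 \<beta> k N x C0 E \<Phi>" and \<eta>: "\<eta> \<in> Vh k N x"
  shows "integral {0..L} (\<lambda>t. E t * \<eta> t)
         = - integral {0..L} (\<lambda>t. \<eta> t * deriv \<Phi> t) - (\<Sum>j=1..N. avg N x \<eta> j * jump N x \<Phi> j)"
proof -
  have E: "E \<in> Vh k N x" and \<Phi>: "\<Phi> \<in> Vh k N x"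
    using P by (auto simp: discrete_poisson_def)
  have i: "(\<lambda>t. \<Phi> t * deriv \<eta> t) \<in> Vh (k + k) N x" "(\<lambda>t. E t * \<eta> t) \<in> Vh (k + k) N x"
    using E \<Phi> \<eta> by (auto intro: Vh_mult Vh_deriv)
  have cell: "cell_integral x j (\<lambda>t. \<Phi> t * deriv \<eta> t)
      - avg N x \<Phi> j * trm N x \<eta> j + avg N x \<Phi> (j - 1) * trp N x \<eta> (j - 1)
      = cell_integral x j (\<lambda>t. E t * \<eta> t)" if "j \<in> {1..N}" for j
    using P \<eta> that unfolding discrete_poisson_def by blast
  have "integral {0..L} (\<lambda>t. E t * \<eta> t) = (\<Sum>j=1..N. 1 * cell_integral x j (\<lambda>t. \<Phi> t * deriv \<eta> t)
      + (- avg N x \<Phi> j * trm N x \<eta> j - - avg N x \<Phi> (j - 1) * trp N x \<eta> (j - 1)))"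
    unfolding sum_cell_integral[OF i(2), symmetric]
    by (rule sum.cong) (simp_all add: cell[symmetric])
  also have "\<dots> = integral {0..L} (\<lambda>t. \<Phi> t * deriv \<eta> t) + (\<Sum>j=1..N. avg N x \<Phi> j * jump N x \<eta> j)"
    by (subst sum_cell_flux[where a = "\<lambda>j. - avg N x \<Phi> j", OF i(1)])
       (simp_all add: avg_periodic sum_negf)
  finally show ?thesis
    using integral_by_parts[OF \<Phi> \<eta>] by (simp add: sum.distrib)
qed

text \<open>Summation leaves \<open>E_hat\<close> against the jumps of \<open>\<zeta>\<close>; its
  penalty part is the source of the \<open>\<beta>\<close> term.\<close>

lemma poisson_divergence:
  assumes P: "discrete_poisson vth \<rho>0 \<beta> k N x C0 E \<Phi>" and \<zeta>: "\<zeta> \<in> Vh k N x"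
    and C0: "C0 \<in> Vh k N x"
  shows "integral {0..L} (\<lambda>t. (vth * C0 t - \<rho>0) * \<zeta> t)
         = - integral {0..L} (\<lambda>t. E t * deriv \<zeta> t) - (\<Sum>j=1..N. avg N x E j * jump N x \<zeta> j)
           + \<beta> * (\<Sum>j=1..N. jump N x \<Phi> j * jump N x \<zeta> j)"
proof -
  have E: "E \<in> Vh k N x" and \<Phi>: "\<Phi> \<in> Vh k N x"
    using P by (auto simp: discrete_poisson_def)
  have "(\<lambda>t. vth * C0 t + - \<rho>0) \<in> Vh k N x"
    using Vh_add[OF Vh_mult[OF Vh_const[of vth 0] C0] Vh_const[of "- \<rho>0"]] by simp
  then have i: "(\<lambda>t. (vth * C0 t - \<rho>0) * \<zeta> t) \<in> Vh (k + k) N x"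
    "(\<lambda>t. E t * deriv \<zeta> t) \<in> Vh (k + k) N x"
    using E \<zeta> Vh_mult[of "\<lambda>t. vth * C0 t + - \<rho>0" k N x \<zeta> k] by (auto intro: Vh_mult Vh_deriv)
  have cell: "- cell_integral x j (\<lambda>t. E t * deriv \<zeta> t)
      + E_hat \<beta> N x E \<Phi> j * trm N x \<zeta> j - E_hat \<beta> N x E \<Phi> (j - 1) * trp N x \<zeta> (j - 1)
      = cell_integral x j (\<lambda>t. (vth * C0 t - \<rho>0) * \<zeta> t)" if "j \<in> {1..N}" for j
    using P \<zeta> that unfolding discrete_poisson_def by blast
  have "integral {0..L} (\<lambda>t. (vth * C0 t - \<rho>0) * \<zeta> t)
      = (\<Sum>j=1..N. - 1 * cell_integral x j (\<lambda>t. E t * deriv \<zeta> t)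
      + (E_hat \<beta> N x E \<Phi> j * trm N x \<zeta> j - E_hat \<beta> N x E \<Phi> (j - 1) * trp N x \<zeta> (j - 1)))"
    unfolding sum_cell_integral[OF i(1), symmetric]
    by (rule sum.cong) (simp_all add: cell[symmetric])
  also have "\<dots> = - integral {0..L} (\<lambda>t. E t * deriv \<zeta> t) - (\<Sum>j=1..N. E_hat \<beta> N x E \<Phi> j * jump N x \<zeta> j)"
    by (subst sum_cell_flux[where a = "E_hat \<beta> N x E \<Phi>", OF i(2)])
       (simp_all add: E_hat_def avg_periodic jump_periodic)
  finally show ?thesis
    by (simp add: E_hat_def sum_subtractf left_diff_distrib sum_distrib_left mult.assoc)
qed

text \<open>Test the gradient equation of \<open>P\<close> with \<open>E'\<close> and the divergence
  equation of \<open>P'\<close> with \<open>\<Phi>\<close>: the volume and average terms agree, so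
  only the penalty separates the two.\<close>

lemma poisson_energy_identity:
  assumes P: "discrete_poisson vth \<rho>0 \<beta> k N x C0 E \<Phi>"
    and P': "discrete_poisson vth \<rho>0 \<beta> k N x C0' E' \<Phi>'"
    and C0': "C0' \<in> Vh k N x"
  shows "integral {0..L} (\<lambda>t. E t * E' t) + \<beta> * (\<Sum>j=1..N. jump N x \<Phi>' j * jump N x \<Phi> j)
         = integral {0..L} (\<lambda>t. (vth * C0' t - \<rho>0) * \<Phi> t)"
proof -
  have "\<Phi> \<in> Vh k N x" "E' \<in> Vh k N x"
    using P P' by (auto simp: discrete_poisson_def)
  then show ?thesis
    using poisson_gradient[OF P, of E'] poisson_divergence[OF P' _ C0', of \<Phi>] by simp
qed

text \<open>Splits off the background term, which later drops out by cancellation or by the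
  vanishing mean of \<open>E\<close>.\<close>

lemma integral_affine_mult:
  assumes u: "u \<in> Vh k N x" and \<phi>: "\<phi> \<in> Vh k N x"
  shows "integral {0..L} (\<lambda>t. (c * u t - d) * \<phi> t)
         = c * integral {0..L} (\<lambda>t. u t * \<phi> t) - d * integral {0..L} \<phi>"
proof -
  have "integral {0..L} (\<lambda>t. (c * u t - d) * \<phi> t)
      = integral {0..L} (\<lambda>t. c * (u t * \<phi> t) - d * \<phi> t)"
    by (simp add: algebra_simps)
  also have "\<dots> = integral {0..L} (\<lambda>t. c * (u t * \<phi> t)) - integral {0..L} (\<lambda>t. d * \<phi> t)"
    using Vh_integrable[OF Vh_mult[OF Vh_const[of c 0] Vh_mult[OF u \<phi>]]]
      Vh_integrable[OF Vh_mult[OF Vh_const[of d 0] \<phi>]] by (rule integral_diff)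
  finally show ?thesis by simp
qed

text \<open>The mixed forms obtained from \<open>P\<close>, \<open>P'\<close> and from
  \<open>P'\<close>, \<open>P\<close> coincide by symmetry. Adding one and subtracting the other
  turns the difference of the diagonal forms into the density difference tested with
  \<open>\<Phi>\<close> and \<open>\<Phi>'\<close>; the background \<open>\<rho>0\<close>
  cancels.\<close>

lemma poisson_energy_difference:
  assumes P: "discrete_poisson vth \<rho>0 \<beta> k N x C0 E \<Phi>" and C0: "C0 \<in> Vh k N x"
    and P': "discrete_poisson vth \<rho>0 \<beta> k N x C0' E' \<Phi>'" and C0': "C0' \<in> Vh k N x"
  shows "(integral {0..L} (\<lambda>t. E' t * E' t) + \<beta> * (\<Sum>j=1..N. jump N x \<Phi>' j * jump N x \<Phi>' j))
         - (integral {0..L} (\<lambda>t. E t * E t) + \<beta> * (\<Sum>j=1..N. jump N x \<Phi> j * jump N x \<Phi> j))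
         = vth * (L2_inner L (\<lambda>t. C0' t - C0 t) \<Phi> + L2_inner L (\<lambda>t. C0' t - C0 t) \<Phi>')"
proof -
  have \<Phi>: "\<Phi> \<in> Vh k N x" "\<Phi>' \<in> Vh k N x"
    using P P' by (auto simp: discrete_poisson_def)
  have L2: "L2_inner L (\<lambda>t. C0' t - C0 t) \<phi>
      = integral {0..L} (\<lambda>t. C0' t * \<phi> t) - integral {0..L} (\<lambda>t. C0 t * \<phi> t)"
    if "\<phi> \<in> Vh k N x" for \<phi>
    unfolding L2_inner_def left_diff_distrib
    by (rule integral_diff[OF Vh_integrable[OF Vh_mult[OF C0' that]]
          Vh_integrable[OF Vh_mult[OF C0 that]]])
  then show ?thesis
    using poisson_energy_identity[OF P P C0, unfolded integral_affine_mult[OF C0 \<Phi>(1)]]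
      poisson_energy_identity[OF P P' C0', unfolded integral_affine_mult[OF C0' \<Phi>(1)]]
      poisson_energy_identity[OF P' P C0, unfolded integral_affine_mult[OF C0 \<Phi>(2)]]
      poisson_energy_identity[OF P' P' C0', unfolded integral_affine_mult[OF C0' \<Phi>(2)]]
    by (simp add: L2[OF \<Phi>(1)] L2[OF \<Phi>(2)] algebra_simps)
qed

section \<open>Transport and source terms\<close>

lemma a_form_const: "a_form vth NH N x C n (\<lambda>t. 1) = 0"
proof -
  have "a_form vth NH N x C n (\<lambda>t. 1) = (\<Sum>j=1..N. g_hat vth NH N x C n j - g_hat vth NH N x C n (j - 1))"
    unfolding a_form_def
    by (rule sum.cong) (use trm_const trp_const in \<open>auto simp: a_cell_def cell_integral_def\<close>)
  then show ?thesis
    using sum_shift_periodic[of "g_hat vth NH N x C n"] by (simp add: sum_subtractf g_hat_periodic)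
qed

text \<open>For \<open>n = 0\<close> the factor \<open>sqrt n\<close> kills the lower neighbour, and
  \<open>NH \<ge> 2\<close> keeps \<open>C 1\<close> below the cutoff of \<open>coef\<close>; hence
  \<open>g\<close> is \<open>vth * C 1\<close>, with flux \<open>vth * C1_hat\<close>.\<close>

lemma a_form_0:
  assumes "NH \<ge> 2" "vth \<noteq> 0" and C1: "C 1 \<in> Vh k N x" and \<phi>: "\<phi> \<in> Vh k N x"
  shows "a_form vth NH N x C 0 \<phi>
         = - vth * (integral {0..L} (\<lambda>t. C 1 t * deriv \<phi> t)
                    + (\<Sum>j=1..N. C1_hat vth NH N x C j * jump N x \<phi> j))"
proof -
  have g0: "g vth NH C 0 t = vth * C 1 t" for t
    using assms(1) by (simp add: g_def coef_def)
  have i: "(\<lambda>t. C 1 t * deriv \<phi> t) \<in> Vh (k + k) N x"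
    using C1 \<phi> by (auto intro: Vh_mult Vh_deriv)
  have gh: "g_hat vth NH N x C 0 j = vth * C1_hat vth NH N x C j" for j
    using assms(2) by (simp add: C1_hat_def)
  have "a_form vth NH N x C 0 \<phi>
      = (\<Sum>j=1..N. - vth * cell_integral x j (\<lambda>t. C 1 t * deriv \<phi> t)
        + (g_hat vth NH N x C 0 j * trm N x \<phi> j - g_hat vth NH N x C 0 (j - 1) * trp N x \<phi> (j - 1)))"
    unfolding a_form_def a_cell_def g0 cell_integral_def by (simp add: mult.assoc algebra_simps)
  also have "\<dots> = - vth * integral {0..L} (\<lambda>t. C 1 t * deriv \<phi> t)
      - (\<Sum>j=1..N. g_hat vth NH N x C 0 j * jump N x \<phi> j)"
    by (rule sum_cell_flux[where a = "g_hat vth NH N x C 0", OF i g_hat_periodic])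
  also have "(\<Sum>j=1..N. g_hat vth NH N x C 0 j * jump N x \<phi> j)
      = vth * (\<Sum>j=1..N. C1_hat vth NH N x C j * jump N x \<phi> j)"
    by (simp only: gh mult.assoc sum_distrib_left)
  finally show ?thesis
    by (simp add: algebra_simps)
qed

lemma b_form_1_const:
  assumes P: "discrete_poisson vth \<rho>0 \<beta> k N x (C 0) E \<Phi>" and C0: "C 0 \<in> Vh k N x"
    and vth: "vth \<noteq> 0"
  shows "b_form vth \<beta> NH N x 1 C E \<Phi> (\<lambda>t. 1) = 0"
proof -
  have E: "E \<in> Vh k N x"
    using P by (auto simp: discrete_poisson_def)
  have i: "(\<lambda>t. E t * C 0 t) \<in> Vh (k + k) N x"
    using E C0 by (rule Vh_mult)
  define S where "S = (\<Sum>j=1..N. jump N x \<Phi> j * jump N x E j)"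
  \<comment> \<open>By the gradient equation tested with 1, periodicity makes the mean of the field
    vanish, so the background \<open>\<rho>0\<close> exerts no net force.\<close>
  have "integral {0..L} E = 0"
    using poisson_divergence[OF P Vh_const[of 1] C0] poisson_gradient[OF P Vh_const[of 1]]
      integral_by_parts[of \<Phi> k "\<lambda>t. 1" k] P Vh_const[of 1]
    by (simp add: discrete_poisson_def jump_const)
  \<comment> \<open>Integration by parts of \<open>E\<close> against itself cancels everything in
    the divergence equation except the penalty.\<close>
  moreover have "integral {0..L} (\<lambda>t. (vth * C 0 t - \<rho>0) * E t) = \<beta> * S"
    using poisson_divergence[OF P E C0] integral_by_parts[OF E E]
    by (simp add: S_def sum_distrib_left[symmetric])
  moreover have "integral {0..L} (\<lambda>t. (vth * C 0 t - \<rho>0) * E t)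
      = vth * integral {0..L} (\<lambda>t. E t * C 0 t) - \<rho>0 * integral {0..L} E"
    using integral_affine_mult[OF C0 E] by (simp add: mult.commute)
  ultimately have EC: "integral {0..L} (\<lambda>t. E t * C 0 t) = \<beta> * S / vth"
    using vth by (simp add: field_simps)
  have "b_form vth \<beta> NH N x 1 C E \<Phi> (\<lambda>t. 1)
      = (\<Sum>j=1..N. - (1 / vth) * cell_integral x j (\<lambda>t. E t * C 0 t)
          + \<beta> / (2 * vth\<^sup>2) * (jump N x \<Phi> (j - 1) * jump N x E (j - 1) + jump N x \<Phi> j * jump N x E j))"
    unfolding b_form_def
    by (rule sum.cong) (use trm_const trp_const in \<open>auto simp: b_cell_def r1_def\<close>)
  \<comment> \<open>Each interface is charged from both adjacent cells, hence \<open>S + S\<close>;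
    the 2 in the denominator of \<open>r1\<close> compensates this.\<close>
  also have "\<dots> = - (1 / vth) * integral {0..L} (\<lambda>t. E t * C 0 t) + \<beta> / (2 * vth\<^sup>2) * (S + S)"
    using sum_shift_periodic[of "\<lambda>j. jump N x \<Phi> j * jump N x E j"]
    by (simp only: sum.distrib sum_distrib_left[symmetric] sum_cell_integral[OF i] S_def jump_periodic)
  also have "\<dots> = 0"
    unfolding EC using vth by (simp add: field_simps power2_eq_square)
  finally show ?thesis .
qed

text \<open>The two end fields are kept apart so that \<open>poisson_gradient\<close> can be applied
  to each. The midpoint halves cancel the double count of every interface in \<open>r2\<close> and
  turn \<open>sqrt 2 / vth\<close> into \<open>1 / (sqrt 2 * vth)\<close>.\<close>

lemma b_form_2_midpoint_const:
  assumes "E \<in> Vh k N x" "E' \<in> Vh k N x" "\<Phi> \<in> Vh k N x" "\<Phi>' \<in> Vh k N x" "C 1 \<in> Vh k N x"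
  shows "b_form vth \<beta> NH N x 2 C (midpoint_fun E E') (midpoint_fun \<Phi> \<Phi>') (\<lambda>t. 1)
    = - (1 / (sqrt 2 * vth)) *
        (integral {0..L} (\<lambda>t. E t * C 1 t) + integral {0..L} (\<lambda>t. E' t * C 1 t)
         + (\<Sum>j=1..N. (avg N x (C 1) j - C1_hat vth NH N x C j) * (jump N x \<Phi> j + jump N x \<Phi>' j)))"
proof -
  define E2 where "E2 = midpoint_fun E E'"
  define \<Phi>2 where "\<Phi>2 = midpoint_fun \<Phi> \<Phi>'"
  define d where "d j = avg N x (C 1) j - C1_hat vth NH N x C j" for j
  have i: "(\<lambda>t. E2 t * C 1 t) \<in> Vh (k + k) N x"
    unfolding E2_def using assms by (intro Vh_mult Vh_midpoint_fun)
  have I: "integral {0..L} (\<lambda>t. E2 t * C 1 t)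
      = (integral {0..L} (\<lambda>t. E t * C 1 t) + integral {0..L} (\<lambda>t. E' t * C 1 t)) / 2"
  proof -
    have "integral {0..L} (\<lambda>t. E2 t * C 1 t) = integral {0..L} (\<lambda>t. (E t * C 1 t + E' t * C 1 t) / 2)"
      by (simp add: E2_def midpoint_fun_def algebra_simps add_divide_distrib)
    also have "\<dots> = integral {0..L} (\<lambda>t. E t * C 1 t + E' t * C 1 t) / 2"
      by simp
    also have "\<dots> = (integral {0..L} (\<lambda>t. E t * C 1 t) + integral {0..L} (\<lambda>t. E' t * C 1 t)) / 2"
      using integral_add[OF Vh_integrable[OF Vh_mult[OF assms(1,5)]] Vh_integrable[OF Vh_mult[OF assms(2,5)]]]
      by simp
    finally show ?thesis .
  qed
  have "b_form vth \<beta> NH N x 2 C E2 \<Phi>2 (\<lambda>t. 1)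
      = (\<Sum>j=1..N. - (sqrt 2 / vth) * cell_integral x j (\<lambda>t. E2 t * C 1 t)
          + - (1 / (sqrt 2 * vth)) * (d (j - 1) * jump N x \<Phi>2 (j - 1) + d j * jump N x \<Phi>2 j))"
    unfolding b_form_def
    by (rule sum.cong) (use trm_const trp_const in \<open>auto simp: b_cell_def r2_def d_def\<close>)
  also have "\<dots> = - (sqrt 2 / vth) * integral {0..L} (\<lambda>t. E2 t * C 1 t)
      + - (1 / (sqrt 2 * vth)) * ((\<Sum>j=1..N. d j * jump N x \<Phi>2 j) + (\<Sum>j=1..N. d j * jump N x \<Phi>2 j))"
    using sum_shift_periodic[of "\<lambda>j. d j * jump N x \<Phi>2 j"]
    by (simp only: sum.distrib sum_distrib_left[symmetric] sum_cell_integral[OF i] jump_periodic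
          avg_periodic g_hat_periodic d_def C1_hat_def)
  also have "(\<Sum>j=1..N. d j * jump N x \<Phi>2 j) = (\<Sum>j=1..N. d j * (jump N x \<Phi> j + jump N x \<Phi>' j)) / 2"
    unfolding sum_divide_distrib \<Phi>2_def
    by (rule sum.cong) (use assms jump_midpoint_fun in auto)
  \<comment> \<open>Gives both source parts a common prefactor; for \<open>vth = 0\<close> division
    by zero yields 0 on either side.\<close>
  also have "sqrt 2 / vth = 2 * (1 / (sqrt 2 * vth))"
    by (cases "vth = 0") (simp_all add: field_simps)
  finally show ?thesis
    unfolding I unfolding E2_def \<Phi>2_def d_def by (simp add: algebra_simps)
qed

section \<open>Conservation over one time step\<close>

lemma L2_inner_diff_const:
  assumes "u \<in> Vh k N x" "w \<in> Vh k N x"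
  shows "L2_inner L (\<lambda>t. u t - w t) (\<lambda>t. 1) = integral {0..L} u - integral {0..L} w"
  using assms by (simp add: L2_inner_def integral_diff Vh_integrable)

text \<open>Separates the moments from the quadratic field energy, the latter in the shape of
  \<open>poisson_energy_difference\<close>; periodicity moves the jump sum from the left to the
  right ends of the cells.\<close>

lemma total_energy_eq:
  assumes "C 0 \<in> Vh k N x" "C 2 \<in> Vh k N x" "E \<in> Vh k N x"
  shows "total_energy L vth \<beta> N x C E \<Phi> =
    vth ^ 3 / 2 * (sqrt 2 * integral {0..L} (C 2) + integral {0..L} (C 0))
    + (integral {0..L} (\<lambda>t. E t * E t) + \<beta> * (\<Sum>j=1..N. jump N x \<Phi> j * jump N x \<Phi> j)) / 2"
proof -
  have c2: "(\<lambda>t. sqrt 2 * C 2 t) \<in> Vh k N x"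
    using Vh_mult[OF Vh_const[of "sqrt 2" 0] assms(2)] by simp
  have c: "(\<lambda>t. vth ^ 3 * (sqrt 2 * C 2 t + C 0 t)) \<in> Vh (0 + k) N x"
    by (intro Vh_mult Vh_const Vh_add assms c2)
  have "integral {0..L} (\<lambda>t. vth ^ 3 * (sqrt 2 * C 2 t + C 0 t) + \<bar>E t\<bar>\<^sup>2)
      = integral {0..L} (\<lambda>t. vth ^ 3 * (sqrt 2 * C 2 t + C 0 t)) + integral {0..L} (\<lambda>t. E t * E t)"
    using integral_add[OF Vh_integrable[OF c] Vh_integrable[OF Vh_mult[OF assms(3,3)]]]
    by (simp add: power2_eq_square)
  also have "integral {0..L} (\<lambda>t. vth ^ 3 * (sqrt 2 * C 2 t + C 0 t))
      = vth ^ 3 * integral {0..L} (\<lambda>t. sqrt 2 * C 2 t + C 0 t)"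
    by simp
  also have "integral {0..L} (\<lambda>t. sqrt 2 * C 2 t + C 0 t)
      = integral {0..L} (\<lambda>t. sqrt 2 * C 2 t) + integral {0..L} (C 0)"
    using c2 assms(1) by (intro integral_add Vh_integrable)
  finally show ?thesis
    using sum_shift_periodic[of "\<lambda>j. jump N x \<Phi> j * jump N x \<Phi> j"]
    by (simp add: total_energy_def power2_eq_square jump_periodic algebra_simps)
qed

text \<open>The coefficients in the fluxes and sources are frozen at the intermediate state, while
  the fields in the equation for index 2 average the two end levels. That average matches the
  potentials \<open>\<Phi>\<close> and \<open>\<Phi>''\<close> in the field energy difference, so
  the exchange of energy balances exactly.\<close>

lemma second_stage_conserves:
  assumes "vth > 0" "dt > 0" "NH \<ge> 3"
    and C: "\<And>n. n < NH \<Longrightarrow> C n \<in> Vh k N x" and C': "\<And>n. n < NH \<Longrightarrow> C' n \<in> Vh k N x"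
    and C'': "\<And>n. n < NH \<Longrightarrow> C'' n \<in> Vh k N x"
    and P: "discrete_poisson vth \<rho>0 \<beta> k N x (C 0) E \<Phi>"
    and P': "discrete_poisson vth \<rho>0 \<beta> k N x (C' 0) E' \<Phi>'"
    and P'': "discrete_poisson vth \<rho>0 \<beta> k N x (C'' 0) E'' \<Phi>''"
    and S: "second_stage L vth \<beta> k NH N x dt C E \<Phi> C' E' \<Phi>' C'' E'' \<Phi>''"
  shows "integral {0..L} (C'' 0) = integral {0..L} (C 0)"
    and "integral {0..L} (C'' 1) = integral {0..L} (C 1)"
    and "total_energy L vth \<beta> N x C'' E'' \<Phi>'' = total_energy L vth \<beta> N x C E \<Phi>"
proof -
  have V: "C 0 \<in> Vh k N x" "C 1 \<in> Vh k N x" "C 2 \<in> Vh k N x" "C' 0 \<in> Vh k N x" "C' 1 \<in> Vh k N x"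
    "C'' 0 \<in> Vh k N x" "C'' 1 \<in> Vh k N x" "C'' 2 \<in> Vh k N x"
    using C C' C'' assms(3) by auto
  have W: "E \<in> Vh k N x" "\<Phi> \<in> Vh k N x" "E'' \<in> Vh k N x" "\<Phi>'' \<in> Vh k N x"
    using P P'' by (auto simp: discrete_poisson_def)
  have S': "L2_inner L (\<lambda>t. C'' n t - C n t) \<phi> / dt
          + a_form vth NH N x C' n \<phi> + b_form vth \<beta> NH N x n C' E' \<Phi>' \<phi> = 0"
    if "n \<in> {0, 1}" "\<phi> \<in> Vh k N x" for n \<phi>
    using S that assms(3) by (auto simp: second_stage_def)
  have S2: "L2_inner L (\<lambda>t. C'' 2 t - C 2 t) \<phi> / dt + a_form vth NH N x C' 2 \<phi>
          + b_form vth \<beta> NH N x 2 C' (midpoint_fun E E'') (midpoint_fun \<Phi> \<Phi>'') \<phi> = 0"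
    if "\<phi> \<in> Vh k N x" for \<phi>
    using S that by (auto simp: second_stage_def)
  have b0: "b_form vth \<beta> NH N x 0 C' E' \<Phi>' \<phi> = 0" for \<phi>
    by (simp add: b_form_def b_cell_def)
  show mass: "integral {0..L} (C'' 0) = integral {0..L} (C 0)"
    using S'[of 0, OF _ Vh_const[of 1]] L2_inner_diff_const[OF V(6,1)] \<open>dt > 0\<close>
    by (simp add: b0 a_form_const)
  \<comment> \<open>The source is evaluated at the intermediate state, so it is the intermediate
    Poisson problem \<open>P'\<close> that removes it.\<close>
  show "integral {0..L} (C'' 1) = integral {0..L} (C 1)"
    using S'[of 1, OF _ Vh_const[of 1]] L2_inner_diff_const[OF V(7,2)] \<open>dt > 0\<close> \<open>vth > 0\<close>
      b_form_1_const[where C = C', OF P' V(4)]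
    by (simp add: a_form_const)
  \<comment> \<open>\<open>D\<close>, \<open>F\<close> and \<open>A\<close> are the volume term, the
    numerical flux and the average flux of \<open>C' 1\<close> against a potential.\<close>
  define D where "D \<phi> = integral {0..L} (\<lambda>t. C' 1 t * deriv \<phi> t)" for \<phi>
  define F where "F \<phi> = (\<Sum>j=1..N. C1_hat vth NH N x C' j * jump N x \<phi> j)" for \<phi>
  define A where "A \<phi> = (\<Sum>j=1..N. avg N x (C' 1) j * jump N x \<phi> j)" for \<phi>
  have transport: "L2_inner L (\<lambda>t. C'' 0 t - C 0 t) \<phi> = dt * vth * (D \<phi> + F \<phi>)"
    if "\<phi> \<in> Vh k N x" for \<phi>
  proof -
    have a: "a_form vth NH N x C' 0 \<phi> = - vth * (D \<phi> + F \<phi>)"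
      using a_form_0[of NH vth C' k \<phi>] V(5) that assms(1,3) by (simp add: D_def F_def)
    then show ?thesis
      using S'[of 0 \<phi>, OF _ that] \<open>dt > 0\<close> unfolding a b0 by (simp add: field_simps)
  qed
  have "integral {0..L} (\<lambda>t. E t * C' 1 t) = - D \<Phi> - A \<Phi>"
    "integral {0..L} (\<lambda>t. E'' t * C' 1 t) = - D \<Phi>'' - A \<Phi>''"
    using poisson_gradient[OF P V(5)] poisson_gradient[OF P'' V(5)] by (simp_all add: D_def A_def)
  \<comment> \<open>The correction \<open>r2\<close> exchanges the average flux \<open>A\<close> for
    the numerical flux \<open>F\<close>, which is the one occurring in
    \<open>transport\<close>.\<close>
  then have b2: "b_form vth \<beta> NH N x 2 C' (midpoint_fun E E'') (midpoint_fun \<Phi> \<Phi>'') (\<lambda>t. 1)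
      = 1 / (sqrt 2 * vth) * (D \<Phi> + D \<Phi>'' + F \<Phi> + F \<Phi>'')"
    using b_form_2_midpoint_const[where C = C', OF W(1,3,2,4) V(5)]
    by (simp add: A_def F_def sum.distrib sum_subtractf algebra_simps)
  have c2: "integral {0..L} (C'' 2) - integral {0..L} (C 2)
      = - dt / (sqrt 2 * vth) * (D \<Phi> + D \<Phi>'' + F \<Phi> + F \<Phi>'')"
    using S2[OF Vh_const[of 1]] \<open>dt > 0\<close> \<open>vth > 0\<close>
    unfolding b2 a_form_const L2_inner_diff_const[OF V(8,3)] by (simp add: field_simps)
  \<comment> \<open>The right side is minus half the field energy change, by
    \<open>transport\<close> at \<open>\<Phi>\<close> and \<open>\<Phi>''\<close>; the
    \<open>C 0\<close> part of the kinetic energy is constant by \<open>mass\<close>.\<close>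
  have "vth ^ 3 / 2 * (sqrt 2 * (integral {0..L} (C'' 2) - integral {0..L} (C 2)))
      = - (vth * (dt * vth * (D \<Phi> + F \<Phi>) + dt * vth * (D \<Phi>'' + F \<Phi>''))) / 2"
    using \<open>vth > 0\<close> unfolding c2 by (simp add: field_simps power3_eq_cube)
  then show "total_energy L vth \<beta> N x C'' E'' \<Phi>'' = total_energy L vth \<beta> N x C E \<Phi>"
    using poisson_energy_difference[OF P V(1) P'' V(6)]
      total_energy_eq[OF V(1,3) W(1)] total_energy_eq[OF V(6,8) W(3)] mass transport[OF W(2)] transport[OF W(4)]
    by (simp add: algebra_simps diff_divide_distrib add_divide_distrib)
qed

end

theorem proposition3p4:
  fixes L vth \<rho>0 \<beta> dt :: real
    and k N NH :: nat
    and x :: "nat \<Rightarrow> real"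
    and C :: "nat \<Rightarrow> nat \<Rightarrow> real \<Rightarrow> real"
    and E \<Phi> :: "nat \<Rightarrow> real \<Rightarrow> real"
  assumes "L > 0" and "vth > 0" and "\<beta> > 0" and "dt > 0" and "NH \<ge> 3"
    and "mesh L N x"
    and "\<And>m n. n < NH \<Longrightarrow> C m n \<in> Vh k N x"
    and "\<And>m. discrete_poisson vth \<rho>0 \<beta> k N x (C m 0) (E m) (\<Phi> m)"
    and "\<And>m. \<exists>C' E' \<Phi>'.
           (\<forall>n<NH. C' n \<in> Vh k N x) \<and>
           discrete_poisson vth \<rho>0 \<beta> k N x (C' 0) E' \<Phi>' \<and>
           first_stage L vth \<beta> k NH N x dt (C m) (E m) (\<Phi> m) C' E' \<Phi>' \<and>
           second_stage L vth \<beta> k NH N x dt (C m) (E m) (\<Phi> m) C' E' \<Phi>'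
             (C (Suc m)) (E (Suc m)) (\<Phi> (Suc m))"
  shows "(\<forall>m. \<forall>l\<in>{0, 1}.
            vth ^ (l + 1) * integral {0..L} (C m l) = vth ^ (l + 1) * integral {0..L} (C 0 l)) \<and>
         (\<forall>m. total_energy L vth \<beta> N x (C m) (E m) (\<Phi> m)
              = total_energy L vth \<beta> N x (C 0) (E 0) (\<Phi> 0))"
proof -
  \<comment> \<open>Each \<open>m\<close> has its own intermediate state; eliminating it here leaves
    equalities between consecutive levels, ready for induction.\<close>
  have step: "integral {0..L} (C (Suc m) 0) = integral {0..L} (C m 0) \<and>
      integral {0..L} (C (Suc m) 1) = integral {0..L} (C m 1) \<and>
      total_energy L vth \<beta> N x (C (Suc m)) (E (Suc m)) (\<Phi> (Suc m))
      = total_energy L vth \<beta> N x (C m) (E m) (\<Phi> m)" for m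
  proof -
    obtain C' E' \<Phi>' where C': "\<forall>n<NH. C' n \<in> Vh k N x"
      and P': "discrete_poisson vth \<rho>0 \<beta> k N x (C' 0) E' \<Phi>'"
      and S: "second_stage L vth \<beta> k NH N x dt (C m) (E m) (\<Phi> m) C' E' \<Phi>'
             (C (Suc m)) (E (Suc m)) (\<Phi> (Suc m))"
      using assms(9)[of m] by blast
    show ?thesis
      using second_stage_conserves[OF assms(6,2,4,5) assms(7) _ assms(7) assms(8) P' assms(8) S] C'
      by blast
  qed
  have "integral {0..L} (C m 0) = integral {0..L} (C 0 0) \<and>
      integral {0..L} (C m 1) = integral {0..L} (C 0 1) \<and>
      total_energy L vth \<beta> N x (C m) (E m) (\<Phi> m)
      = total_energy L vth \<beta> N x (C 0) (E 0) (\<Phi> 0)" for m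
    by (induction m) (use step in auto)
  then show ?thesis
    by auto
qed

end
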